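(* Let $a,b$ be positive integers, let $\sigma$ be an integer-valued function on the vertices of the complete bipartite graph $K_{a,b}$, with the vertices of each side labeled so that $\sigma(L_1)\ge\cdots\ge\sigma(L_a)$ and $\sigma(R_1)\ge\cdots\ge\sigma(R_b)$, and let $0\le k\le a$ and $0\le\ell\le b$ be integers. If $\sigma$ and its conjugate $c^{k,\ell}\sigma$ are both nonnegative configurations, then $$A(c^{k,\ell}\sigma)=A(\sigma),$$ where $A$ denotes activity.
   Context: $K_{a,b}$ has sides $L=\{L_1,\dots,L_a\}$ and $R=\{R_1,\dots,R_b\}$, so vertices of $L$ have degree $b$ and vertices of $R$ have degree $a$. A nonnegative configuration is a function from the vertex set to the nonnegative integers. In one round of parallel chip-firing, every vertex $v$ with $\sigma(v)\ge\deg(v)$ fires, all simultaneously: each firing vertex sends one chip to each of its neighbors. Write $U\sigma$ for the configuration after one round, so $U\sigma(v)=\sigma(v)-\deg(v)\,F_0(v)+\sum_{w\sim v}F_0(w)$, where $F_t(v)\in\{0,1\}$ indicates whether $v$ fires from $U^t\sigma$ (i.e. whether $U^t\sigma(v)\ge\deg(v)$). Put $u_t(\sigma,v)=\sum_{s=0}^{t-1}F_s(v)$. The activity of $\sigma$ is $$A(\sigma)=\lim_{t\to\infty}\frac{1}{(a+b)t}\sum_{v\in L\cup R}u_t(\sigma,v)$$ (the limit exists because the dynamics is eventually periodic). Two-parameter conjugate: with the vertices of each side labeled so that $\sigma(L_1)\ge\cdots\ge\sigma(L_a)$ and $\sigma(R_1)\ge\cdots\ge\sigma(R_b)$, and for $0\le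 k\le a$, $0\le\ell\le b$, define $$c^{k,\ell}\sigma(L_i)=\begin{cases}\sigma(L_i)+\ell-b,& i\le k,\\ \sigma(L_i)+\ell,& i>k,\end{cases}\qquad c^{k,\ell}\sigma(R_j)=\begin{cases}\sigma(R_j)+k-a,& j\le\ell,\\ \sigma(R_j)+k,& j>\ell.\end{cases}$$ *)

theory Defs
  imports Complex_Main
begin

datatype vertex = L nat | R nat

definition verts :: "nat \<Rightarrow> nat \<Rightarrow> vertex set" where
  "verts a b = L ` {1..a} \<union> R ` {1..b}"

definition edges :: "nat \<Rightarrow> nat \<Rightarrow> vertex set set" where
  "edges a b = {{L i, R j} | i j. i \<in> {1..a} \<and> j \<in> {1..b}}"

definition nbrs :: "nat \<Rightarrow> nat \<Rightarrow> vertex \<Rightarrow> vertex set" where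
  "nbrs a b v = {w. {v, w} \<in> edges a b}"

definition degree :: "nat \<Rightarrow> nat \<Rightarrow> vertex \<Rightarrow> nat" where
  "degree a b v = card (nbrs a b v)"

lemma nbrs_L: "i \<in> {1..a} \<Longrightarrow> nbrs a b (L i) = R ` {1..b}"
  by (auto simp: nbrs_def edges_def doubleton_eq_iff)

lemma nbrs_R: "j \<in> {1..b} \<Longrightarrow> nbrs a b (R j) = L ` {1..a}"
  by (auto simp: nbrs_def edges_def doubleton_eq_iff)

lemma degree_L: "i \<in> {1..a} \<Longrightarrow> degree a b (L i) = b"
  by (simp add: degree_def nbrs_L card_image inj_on_def)

lemma degree_R: "j \<in> {1..b} \<Longrightarrow> degree a b (R j) = a"
  by (simp add: degree_def nbrs_R card_image inj_on_def)

text \<open>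
  Chip values are integers, so that the conjugate below is defined without truncation.
  Functions on the vertex set of \<open>K\<^bsub>a,b\<^esub>\<close> are represented by functions on the whole type;
  their values outside \<open>verts a b\<close> are irrelevant, as \<open>nbrs\<close> only yields elements
  of \<open>verts a b\<close>.
\<close>

type_synonym config = "vertex \<Rightarrow> int"

definition nonneg_config :: "nat \<Rightarrow> nat \<Rightarrow> config \<Rightarrow> bool" where
  "nonneg_config a b \<sigma> \<longleftrightarrow> (\<forall>v \<in> verts a b. \<sigma> v \<ge> 0)"

definition fires :: "nat \<Rightarrow> nat \<Rightarrow> config \<Rightarrow> vertex \<Rightarrow> bool" where
  "fires a b \<sigma> v \<longleftrightarrow> \<sigma> v \<ge> int (degree a b v)"

definition step :: "nat \<Rightarrow> nat \<Rightarrow> config \<Rightarrow> config" where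
  "step a b \<sigma> v =
     \<sigma> v - int (degree a b v) * of_bool (fires a b \<sigma> v)
         + (\<Sum>w \<in> nbrs a b v. of_bool (fires a b \<sigma> w))"

definition fire_count :: "nat \<Rightarrow> nat \<Rightarrow> nat \<Rightarrow> config \<Rightarrow> vertex \<Rightarrow> nat" where
  "fire_count a b t \<sigma> v = (\<Sum>s<t. of_bool (fires a b ((step a b ^^ s) \<sigma>) v))"

definition activity :: "nat \<Rightarrow> nat \<Rightarrow> config \<Rightarrow> real" where
  "activity a b \<sigma> =
     lim (\<lambda>t. 1 / (real (a + b) * real t) * (\<Sum>v \<in> verts a b. real (fire_count a b t \<sigma> v)))"

definition sorted_labels :: "nat \<Rightarrow> nat \<Rightarrow> config \<Rightarrow> bool" where
  "sorted_labels a b \<sigma> \<longleftrightarrow>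
     antimono_on {1..a} (\<lambda>i. \<sigma> (L i)) \<and> antimono_on {1..b} (\<lambda>j. \<sigma> (R j))"

text \<open>Meaningful as a conjugate only for \<open>\<sigma>\<close> satisfying \<open>sorted_labels a b\<close>.\<close>

primrec conjugate :: "nat \<Rightarrow> nat \<Rightarrow> nat \<Rightarrow> nat \<Rightarrow> config \<Rightarrow> config" where
  "conjugate a b k l \<sigma> (L i) =
     (if i \<le> k then \<sigma> (L i) + int l - int b else \<sigma> (L i) + int l)"
| "conjugate a b k l \<sigma> (R j) =
     (if j \<le> l then \<sigma> (R j) + int k - int a else \<sigma> (R j) + int k)"

end

theory Submission
  imports Defs
begin

text \<open>
  The odometer \<open>u\<close> of \<open>\<sigma>\<close> evolves by \<open>u v \<mapsto> u v + [\<sigma> v - deg v * u v + (\<Sum>w\<sim>v. u w) \<ge> deg v]\<close>,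
  a map that is monotone and commutes with adding constants. The conjugate is \<open>\<sigma>\<close> after firing
  (perhaps illegally) the set \<open>S = {L 1, \<dots>, L k, R 1, \<dots>, R l}\<close>, so its odometer plus \<open>1\<^sub>S\<close> is
  the orbit of \<open>1\<^sub>S\<close> under the same map. As \<open>0 \<le> 1\<^sub>S \<le> 1\<close>, this orbit stays between the orbit of
  \<open>0\<close> and that orbit plus \<open>1\<close>: the two odometers differ by at most one everywhere.
\<close>

lemma nbrs_subset_verts: "nbrs a b v \<subseteq> verts a b"
  by (auto simp: nbrs_def edges_def verts_def doubleton_eq_iff)

text \<open>This is \<open>\<sigma>\<close> minus the graph Laplacian applied to \<open>x\<close>.
  Legality is ignored and \<open>x\<close> may be any integer function.\<close>

definition fire_by :: "nat \<Rightarrow> nat \<Rightarrow> (vertex \<Rightarrow> int) \<Rightarrow> config \<Rightarrow> config" where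
  "fire_by a b x \<sigma> v = \<sigma> v - int (degree a b v) * x v + (\<Sum>w \<in> nbrs a b v. x w)"

text \<open>Constants lie in the kernel of the Laplacian: firing every vertex once changes
  nothing.\<close>

lemma fire_by_complement:
  "fire_by a b (\<lambda>v. 1 - x v) (fire_by a b x \<sigma>) v = \<sigma> v"
  by (simp add: fire_by_def degree_def sum_subtractf algebra_simps)

lemma fire_count_0: "fire_count a b 0 \<sigma> v = 0"
  by (simp add: fire_count_def)

lemma fire_count_Suc:
  "fire_count a b (Suc t) \<sigma> v
     = fire_count a b t \<sigma> v + of_bool (fires a b ((step a b ^^ t) \<sigma>) v)"
  by (simp add: fire_count_def)

lemma step_funpow_eq_fire_by:
  "(step a b ^^ t) \<sigma> v = fire_by a b (\<lambda>w. int (fire_count a b t \<sigma> w)) \<sigma> v"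
proof (induction t arbitrary: v)
  case 0
  show ?case by (simp add: fire_by_def fire_count_0)
next
  case (Suc t)
  have "(step a b ^^ Suc t) \<sigma> v = step a b ((step a b ^^ t) \<sigma>) v"
    by simp
  also have "\<dots> = fire_by a b (\<lambda>w. int (fire_count a b t \<sigma> w)) \<sigma> v
      - int (degree a b v) * of_bool (fires a b ((step a b ^^ t) \<sigma>) v)
      + (\<Sum>w \<in> nbrs a b v. of_bool (fires a b ((step a b ^^ t) \<sigma>) w))"
    by (subst step_def) (simp only: Suc.IH)
  also have "\<dots> = fire_by a b (\<lambda>w. int (fire_count a b (Suc t) \<sigma> w)) \<sigma> v"
    by (simp add: fire_by_def fire_count_Suc sum.distrib distrib_left)
  finally show ?case .
qed

text \<open>Induction on \<open>t\<close>: a strict inequality at \<open>v\<close> survives a round,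
  since the left side grows by at most one. In case of equality, \<open>v\<close> fires from the
  orbit of \<open>\<tau>\<close> whenever it fires from that of \<open>\<sigma>\<close>.\<close>

lemma fire_count_le_fire_by:
  assumes \<tau>: "\<And>v. v \<in> verts a b \<Longrightarrow> \<tau> v = fire_by a b x \<sigma> v"
    and x: "\<And>v. v \<in> verts a b \<Longrightarrow> 0 \<le> x v"
    and "v \<in> verts a b"
  shows "int (fire_count a b t \<sigma> v) \<le> int (fire_count a b t \<tau> v) + x v"
  using \<open>v \<in> verts a b\<close>
proof (induction t arbitrary: v)
  case 0
  then show ?case using x by (simp add: fire_count_0)
next
  case (Suc t)
  let ?u = "\<lambda>\<rho> w. int (fire_count a b t \<rho> w)"
  show ?case
  proof (cases "?u \<sigma> v = ?u \<tau> v + x v")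
    case False
    then show ?thesis using Suc.IH[OF Suc.prems] by (simp add: fire_count_Suc)
  next
    case True
    have "(\<Sum>w \<in> nbrs a b v. ?u \<sigma> w) \<le> (\<Sum>w \<in> nbrs a b v. ?u \<tau> w + x w)"
      using nbrs_subset_verts by (intro sum_mono Suc.IH) blast
    \<comment> \<open>By \<open>True\<close> the degree terms cancel, which leaves only the chips
      received from neighbors to compare.\<close>
    then have "(step a b ^^ t) \<sigma> v \<le> (step a b ^^ t) \<tau> v"
      unfolding step_funpow_eq_fire_by
      using True by (simp add: fire_by_def \<tau>[OF Suc.prems] sum.distrib distrib_left)
    then show ?thesis
      using True by (auto simp: fire_count_Suc fires_def)
  qed
qed

lemma activity_eqI:
  assumes close: "\<And>t v. v \<in> verts a b \<Longrightarrow>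
      \<bar>int (fire_count a b t \<sigma> v) - int (fire_count a b t \<tau> v)\<bar> \<le> 1"
  shows "activity a b \<sigma> = activity a b \<tau>"
proof -
  let ?f = "\<lambda>\<rho> t. 1 / (real (a + b) * real t) *
    (\<Sum>v \<in> verts a b. real (fire_count a b t \<rho> v))"
  let ?C = "real (card (verts a b)) / real (a + b)"
  \<comment> \<open>This covers \<open>t = 0\<close> too, where division by zero makes both sides
    0.\<close>
  have "norm (?f \<sigma> t - ?f \<tau> t) \<le> norm (1 / real t) * ?C" for t
  proof -
    let ?d = "\<Sum>v \<in> verts a b. real (fire_count a b t \<sigma> v) - real (fire_count a b t \<tau> v)"
    have "\<bar>?d\<bar> \<le> (\<Sum>v \<in> verts a b. \<bar>real (fire_count a b t \<sigma> v) - real (fire_count a b t \<tau> v)\<bar>)"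
      by (rule sum_abs)
    also have "\<dots> \<le> (\<Sum>v \<in> verts a b. 1)"
    proof (rule sum_mono)
      fix v assume "v \<in> verts a b"
      from close[OF this, of t]
      show "\<bar>real (fire_count a b t \<sigma> v) - real (fire_count a b t \<tau> v)\<bar> \<le> 1"
        by linarith
    qed
    finally have "\<bar>?d\<bar> \<le> real (card (verts a b))" by simp
    then have "1 / (real (a + b) * real t) * \<bar>?d\<bar>
        \<le> 1 / (real (a + b) * real t) * real (card (verts a b))"
      by (intro mult_left_mono) simp_all
    moreover have "?f \<sigma> t - ?f \<tau> t = 1 / (real (a + b) * real t) * ?d"
      by (simp only: sum_subtractf right_diff_distrib)
    ultimately show ?thesis
      by (simp add: abs_mult mult.commute[of "real t"])
  qed
  then have diff: "(\<lambda>t. ?f \<sigma> t - ?f \<tau> t) \<longlonglongrightarrow> 0"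
    by (intro tendsto_0_le[OF lim_1_over_n] always_eventually) blast
  have "?f \<sigma> \<longlonglongrightarrow> c \<longleftrightarrow> ?f \<tau> \<longlonglongrightarrow> c" for c
    by (rule Lim_transform_eq[OF diff])
  \<comment> \<open>\<open>lim\<close> is a definite description, so it suffices that both sequences have the same limits, if any.\<close>
  then show ?thesis
    by (simp only: activity_def lim_def)
qed

lemma conjugate_eq_fire_by:
  assumes "k \<le> a" "l \<le> b" "v \<in> verts a b"
  shows "conjugate a b k l \<sigma> v
    = fire_by a b (\<lambda>v. of_bool (v \<in> L ` {..k} \<union> R ` {..l})) \<sigma> v"
proof -
  \<comment> \<open>A vertex receives one chip from each fired neighbor. The index 0 in
    \<open>{..k}\<close> and \<open>{..l}\<close> labels no vertex, so these chips number exactly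
    \<open>k\<close> or \<open>l\<close>.\<close>
  have sum_le: "(\<Sum>i = 1..n. of_bool (i \<le> m)) = int m" if "m \<le> n" for m n :: nat
  proof -
    have "{1..n} \<inter> {i. i \<le> m} = {1..m}" using that by auto
    then show ?thesis by simp
  qed
  have inj: "inj_on L A" "inj_on R A" for A
    by (simp_all add: inj_on_def)
  have mem: "L i \<in> L ` {..k} \<union> R ` {..l} \<longleftrightarrow> i \<le> k" "R i \<in> L ` {..k} \<union> R ` {..l} \<longleftrightarrow> i \<le> l" for i
    by auto
  from \<open>v \<in> verts a b\<close> consider i where "v = L i" "i \<in> {1..a}" | j where "v = R j" "j \<in> {1..b}"
    by (auto simp: verts_def)
  then show ?thesis
    by cases (simp_all only: fire_by_def nbrs_L nbrs_R degree_L degree_R sum.reindex[OF inj(1)]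
        sum.reindex[OF inj(2)] o_def mem sum_le assms conjugate.simps, simp_all)
qed

theorem proposition3:
  fixes a b k l :: nat and \<sigma> :: config
  assumes "a > 0" and "b > 0"
    and "sorted_labels a b \<sigma>"
    and "k \<le> a" and "l \<le> b"
    and "nonneg_config a b \<sigma>"
    and "nonneg_config a b (conjugate a b k l \<sigma>)"
  shows "activity a b (conjugate a b k l \<sigma>) = activity a b \<sigma>"
proof (rule activity_eqI)
  fix t v assume v: "v \<in> verts a b"
  let ?\<tau> = "conjugate a b k l \<sigma>"
  define x :: "vertex \<Rightarrow> int" where "x = (\<lambda>v. of_bool (v \<in> L ` {..k} \<union> R ` {..l}))"
  have x: "0 \<le> x v" "x v \<le> 1" for v
    by (simp_all add: x_def)
  have \<tau>: "?\<tau> v = fire_by a b x \<sigma> v" if "v \<in> verts a b" for v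
    unfolding x_def using assms that by (intro conjugate_eq_fire_by)
  \<comment> \<open>Firing the complementary set undoes the conjugation, so the comparison also
    applies with the two configurations exchanged.\<close>
  have \<sigma>: "\<sigma> v = fire_by a b (\<lambda>v. 1 - x v) ?\<tau> v" if "v \<in> verts a b" for v
  proof -
    \<comment> \<open>\<open>fire_by\<close> reads its configuration only at \<open>v\<close>, so
      agreement on \<open>verts a b\<close> suffices.\<close>
    have "fire_by a b (\<lambda>v. 1 - x v) ?\<tau> v = fire_by a b (\<lambda>v. 1 - x v) (fire_by a b x \<sigma>) v"
      using \<tau>[OF that] by (simp add: fire_by_def)
    then show ?thesis by (simp add: fire_by_complement)
  qed
  have "int (fire_count a b t \<sigma> v) \<le> int (fire_count a b t ?\<tau> v) + x v"
    using \<tau> x v by (intro fire_count_le_fire_by) auto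
  moreover have "int (fire_count a b t ?\<tau> v) \<le> int (fire_count a b t \<sigma> v) + (1 - x v)"
    using \<sigma> x v by (intro fire_count_le_fire_by[where x = "\<lambda>v. 1 - x v"]) auto
  ultimately show "\<bar>int (fire_count a b t ?\<tau> v) - int (fire_count a b t \<sigma> v)\<bar> \<le> 1"
    using x[of v] by linarith
qed

end
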